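(* Let $\mathbb{H}$ and $\mathbb{K}$ be complex Hilbert spaces, and let $A$ be a bounded linear operator on $\mathbb{H}$ and $B$ a bounded linear operator on $\mathbb{K}$. Then $$w^2(A \otimes B) \geq \frac{\|A^*A \otimes B^*B+AA^* \otimes BB^*\|}{4} + \frac{\Big|\,\|A \otimes B+A^* \otimes B^*\|^2-\|A \otimes B-A^* \otimes B^*\|^2\,\Big|}{8}.$$
   Context: For a bounded linear operator $T$ on a complex Hilbert space with inner product $\langle\cdot,\cdot\rangle$, the numerical radius is $w(T)=\sup\{|\langle Tx,x\rangle| : \|x\|=1\}$, $w^2(T)$ denotes $(w(T))^2$, and $\|T\|$ is the operator norm. $\mathbb{H}\otimes\mathbb{K}$ is the Hilbert space tensor product (the completion of the algebraic tensor product under the inner product determined by $\langle x\otimes y,z\otimes u\rangle=\langle x,z\rangle\langle y,u\rangle$), and $A\otimes B$ is the bounded linear operator on $\mathbb{H}\otimes\mathbb{K}$ determined by $(A\otimes B)(x\otimes y)=Ax\otimes By$. *)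

theory Defs
  imports "HOL-Analysis.Analysis"
begin

section \<open>Complex Hilbert spaces\<close>

class complex_vector = real_vector +
  fixes scaleC :: "complex \<Rightarrow> 'a \<Rightarrow> 'a" (infixr "*\<^sub>C" 75)
  assumes scaleC_add_right: "a *\<^sub>C (x + y) = a *\<^sub>C x + a *\<^sub>C y"
    and scaleC_add_left: "(a + b) *\<^sub>C x = a *\<^sub>C x + b *\<^sub>C x"
    and scaleC_scaleC: "a *\<^sub>C (b *\<^sub>C x) = (a * b) *\<^sub>C x"
    and scaleC_one: "1 *\<^sub>C x = x"
    and scaleR_scaleC: "r *\<^sub>R x = complex_of_real r *\<^sub>C x"

text \<open>The inner product is linear in its first argument. The parent class
  \<open>real_normed_vector\<close> ties the metric and the topology to the norm, and
  \<open>norm_eq_sqrt_cinner\<close> ties the norm to the inner product.\<close>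

class complex_inner = complex_vector + real_normed_vector +
  fixes cinner :: "'a \<Rightarrow> 'a \<Rightarrow> complex"
  assumes cinner_commute: "cinner x y = cnj (cinner y x)"
    and cinner_add_left: "cinner (x + y) z = cinner x z + cinner y z"
    and cinner_scaleC_left: "cinner (a *\<^sub>C x) y = a * cinner x y"
    and cinner_ge_zero: "0 \<le> Re (cinner x x)"
    and cinner_eq_zero_iff: "cinner x x = 0 \<longleftrightarrow> x = 0"
    and norm_eq_sqrt_cinner: "norm x = sqrt (Re (cinner x x))"

class chilbert_space = complex_inner + complete_space

subclass (in chilbert_space) banach ..

global_interpretation complex_vector: vector_space "scaleC :: complex \<Rightarrow> 'a \<Rightarrow> 'a::complex_vector"
  by unfold_locales (simp_all add: scaleC_add_right scaleC_add_left scaleC_scaleC scaleC_one)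

abbreviation clinear :: "('a::complex_vector \<Rightarrow> 'b::complex_vector) \<Rightarrow> bool" where
  "clinear \<equiv> Vector_Spaces.linear scaleC scaleC"

abbreviation cspan :: "'a::complex_vector set \<Rightarrow> 'a set" where
  "cspan \<equiv> complex_vector.span"

instantiation complex :: chilbert_space
begin

definition scaleC_complex :: "complex \<Rightarrow> complex \<Rightarrow> complex" where
  "scaleC_complex a x = a * x"

definition cinner_complex :: "complex \<Rightarrow> complex \<Rightarrow> complex" where
  "cinner_complex x y = x * cnj y"

instance
proof
  fix x :: complex
  show "norm x = sqrt (Re (cinner x x))"
    by (simp add: cinner_complex_def cmod_def power2_eq_square)
qed (auto simp: scaleC_complex_def cinner_complex_def algebra_simps scaleR_conv_of_real)

end


section \<open>Bounded operators\<close>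

definition bounded_clinear :: "('a::complex_inner \<Rightarrow> 'b::complex_inner) \<Rightarrow> bool" where
  "bounded_clinear T \<longleftrightarrow> clinear T \<and> (\<exists>K. \<forall>x. norm (T x) \<le> K * norm x)"

text \<open>For a bounded operator on a Hilbert space the adjoint exists by the Riesz theorem,
  and the defining equation determines it.\<close>

definition cadjoint :: "('a::chilbert_space \<Rightarrow> 'b::chilbert_space) \<Rightarrow> 'b \<Rightarrow> 'a" where
  "cadjoint T = (THE S. \<forall>x y. cinner (T x) y = cinner x (S y))"

text \<open>On the zero space there is no unit vector and the supremum of the empty set of reals is
  an unspecified real number.\<close>

definition numerical_radius :: "('a::chilbert_space \<Rightarrow> 'a) \<Rightarrow> real" where
  "numerical_radius T = (SUP x\<in>{x. norm x = 1}. cmod (cinner (T x) x))"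


section \<open>The Hilbert space tensor product\<close>

text \<open>\<open>hilbert_tensor_product tens\<close> says that the Hilbert space \<open>'t\<close>, with the elementary
  tensors \<open>tens x y\<close>, is the tensor product of \<open>'h\<close> and \<open>'k\<close>. The first three conditions
  say that \<open>tens\<close> induces an isometric (hence injective) linear map from the algebraic tensor
  product with its inner product into \<open>'t\<close>. The last one says that its image is dense, so
  that the complete space \<open>'t\<close> is a completion of the algebraic tensor product. These
  conditions determine \<open>'t\<close> and \<open>tens\<close> up to a unique unitary map.\<close>

definition hilbert_tensor_product ::
    "('h::chilbert_space \<Rightarrow> 'k::chilbert_space \<Rightarrow> 't::chilbert_space) \<Rightarrow> bool" where
  "hilbert_tensor_product tens \<longleftrightarrow>
     (\<forall>x. clinear (\<lambda>y. tens x y)) \<and>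
     (\<forall>y. clinear (\<lambda>x. tens x y)) \<and>
     (\<forall>x y z u. cinner (tens x y) (tens z u) = cinner x z * cinner y u) \<and>
     closure (cspan {tens x y |x y. True}) = UNIV"

text \<open>The operator written \<open>A \<otimes> B\<close>; for bounded \<open>A\<close> and \<open>B\<close> it exists, and it is unique
  because the elementary tensors span a dense subspace.\<close>

definition tensor_op ::
    "('h::chilbert_space \<Rightarrow> 'k::chilbert_space \<Rightarrow> 't::chilbert_space) \<Rightarrow>
     ('h \<Rightarrow> 'h) \<Rightarrow> ('k \<Rightarrow> 'k) \<Rightarrow> 't \<Rightarrow> 't" where
  "tensor_op tens A B =
     (THE T. bounded_clinear T \<and> (\<forall>x y. T (tens x y) = tens (A x) (B y)))"

end

theory Submission
  imports Defs
begin

text \<open>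
  Put \<open>T = A \<otimes> B\<close>. Its adjoint is \<open>A\<^sup>* \<otimes> B\<^sup>*\<close>, and the first operator on the right-hand
  side is \<open>T\<^sup>*T + TT\<^sup>*\<close>, so the claim is an inequality about a single bounded operator on a Hilbert
  space. Write \<open>p\<close> and \<open>q\<close> for the norms of \<open>T + T\<^sup>*\<close> and \<open>T - T\<^sup>*\<close>, which are twice the norms
  of the real and the imaginary part of \<open>T\<close>. From
  \<open>2 (T\<^sup>*T + TT\<^sup>*) = (T + T\<^sup>*)\<^sup>2 - (T - T\<^sup>*)\<^sup>2\<close> one gets
  \<open>\<parallel>T\<^sup>*T + TT\<^sup>*\<parallel> \<le> (p\<^sup>2 + q\<^sup>2) / 2\<close>, so the right-hand side of the claim is at most
  \<open>(p\<^sup>2 + q\<^sup>2) / 8 + \<bar>p\<^sup>2 - q\<^sup>2\<bar> / 8 = max (p\<^sup>2) (q\<^sup>2) / 4\<close>. On a nonzero space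
  both \<open>p\<close> and \<open>q\<close> are at most \<open>2 w(T)\<close>, because the norm of a self-adjoint operator is governed by
  its quadratic form; on the zero space they vanish. This is \<open>numerical_radius_square_ge\<close>.

  The reduction to a single operator needs that the adjoint and the tensor product of bounded
  operators exist, since both are definite descriptions. The adjoint comes from the Riesz
  theorem, proved here by minimising a quadratic functional. For the tensor product it is enough
  to construct \<open>A \<otimes> I\<close> and, exchanging the factors, \<open>I \<otimes> B\<close>, and to compose them. A vector in
  the span of the elementary tensors can be written as \<open>\<Sum> x\<^sub>i \<otimes> e\<^sub>i\<close> with orthonormal \<open>e\<^sub>i\<close>; then its
  squared norm is \<open>\<Sum> \<parallel>x\<^sub>i\<parallel>\<^sup>2\<close>, and it is evident that \<open>\<Sum> x\<^sub>i \<otimes> e\<^sub>i \<mapsto> \<Sum> A x\<^sub>i \<otimes> e\<^sub>i\<close> is bounded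
  by the norm of \<open>A\<close>. Boundedness also gives that the map is well defined and that it extends to
  the closure. Identities between bounded operators on the tensor product are then checked on
  elementary tensors (\<open>hilbert_tensor_induct\<close>).
\<close>

section \<open>Complex inner products\<close>

lemma cinner_add_right: "cinner x (y + z) = cinner x y + cinner x z"
  by (metis cinner_add_left cinner_commute complex_cnj_add)

lemma cinner_scaleC_right: "cinner x (a *\<^sub>C y) = cnj a * cinner x y"
  by (metis cinner_commute cinner_scaleC_left complex_cnj_mult)

lemma cinner_zero_left [simp]: "cinner 0 y = 0"
  using cinner_add_left[of 0 0 y] by simp

lemma cinner_zero_right [simp]: "cinner x 0 = 0"
  using cinner_add_right[of x 0 0] by simp

lemma cinner_minus_left: "cinner (- x) y = - cinner x y"
  using cinner_add_left[of x "- x" y] by (simp add: eq_neg_iff_add_eq_0 add.commute)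

lemma cinner_minus_right: "cinner x (- y) = - cinner x y"
  by (metis cinner_commute cinner_minus_left complex_cnj_minus)

lemma cinner_diff_left: "cinner (x - y) z = cinner x z - cinner y z"
  using cinner_add_left[of x "- y" z] by (simp add: cinner_minus_left)

lemma cinner_diff_right: "cinner x (y - z) = cinner x y - cinner x z"
  using cinner_add_right[of x y "- z"] by (simp add: cinner_minus_right)

lemma cinner_scaleR_left: "cinner (r *\<^sub>R x) y = of_real r * cinner x y"
  by (simp add: scaleR_scaleC cinner_scaleC_left)

lemma cinner_scaleR_right: "cinner x (r *\<^sub>R y) = of_real r * cinner x y"
  by (simp add: scaleR_scaleC cinner_scaleC_right)

lemma cinner_sum_left: "cinner (sum f I) y = (\<Sum>i\<in>I. cinner (f i) y)"
  by (induction I rule: infinite_finite_induct) (auto simp: cinner_add_left)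

lemma cinner_sum_right: "cinner x (sum f I) = (\<Sum>i\<in>I. cinner x (f i))"
  by (induction I rule: infinite_finite_induct) (auto simp: cinner_add_right)

lemma Re_cinner_self: "Re (cinner x x) = (norm x)\<^sup>2"
  by (simp add: norm_eq_sqrt_cinner cinner_ge_zero)

lemma cinner_self: "cinner x x = of_real ((norm x)\<^sup>2)"
proof -
  have "Im (cinner x x) = 0"
    using arg_cong[OF cinner_commute[of x x], of Im] by simp
  then show ?thesis by (simp add: complex_eq_iff Re_cinner_self)
qed

lemma Re_cinner_commute: "Re (cinner x y) = Re (cinner y x)"
  by (subst cinner_commute) simp

lemma norm_add_square: "(norm (x + y))\<^sup>2 = (norm x)\<^sup>2 + (norm y)\<^sup>2 + 2 * Re (cinner x y)"
  for x y :: "'a::complex_inner"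
  unfolding Re_cinner_self[symmetric]
  by (simp add: cinner_add_left cinner_add_right Re_cinner_commute[of y x])

lemma norm_diff_square: "(norm (x - y))\<^sup>2 = (norm x)\<^sup>2 + (norm y)\<^sup>2 - 2 * Re (cinner x y)"
  for x y :: "'a::complex_inner"
  unfolding Re_cinner_self[symmetric]
  by (simp add: cinner_diff_left cinner_diff_right Re_cinner_commute[of y x])

text \<open>The norm is only assumed to be compatible with real scalars; for complex ones this
  follows from the inner product.\<close>

lemma norm_scaleC: "norm (a *\<^sub>C x) = cmod a * norm x" for x :: "'a::complex_inner"
proof -
  have "cinner (a *\<^sub>C x) (a *\<^sub>C x) = of_real ((cmod a * norm x)\<^sup>2)"
    unfolding cinner_scaleC_left cinner_scaleC_right cinner_self[of x] power_mult_distrib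
      of_real_mult complex_norm_square by (simp add: ac_simps)
  then have "(norm (a *\<^sub>C x))\<^sup>2 = (cmod a * norm x)\<^sup>2"
    unfolding cinner_self of_real_eq_iff .
  then show ?thesis by simp
qed

text \<open>The real Cauchy--Schwarz inequality is the nonnegativity of the squared norm of
  \<open>\<parallel>y\<parallel> x - \<parallel>x\<parallel> y\<close>.\<close>

lemma Re_cinner_le: "Re (cinner x y) \<le> norm x * norm y" for x y :: "'a::complex_inner"
proof -
  have "0 \<le> (norm (norm y *\<^sub>R x - norm x *\<^sub>R y))\<^sup>2" by simp
  also have "\<dots> = 2 * (norm x * norm y) * (norm x * norm y - Re (cinner x y))"
    unfolding norm_diff_square
    by (simp add: cinner_scaleR_left cinner_scaleR_right algebra_simps power2_eq_square)
  finally have "0 \<le> (norm x * norm y) * (norm x * norm y - Re (cinner x y))" by simp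
  then show ?thesis
    by (cases "norm x * norm y = 0")
      (auto simp: zero_le_mult_iff not_le mult_less_0_iff dest: order_antisym)
qed

text \<open>Rotating \<open>x\<close> makes the inner product real and nonnegative, which reduces the complex
  inequality to the real one.\<close>

lemma cmod_cinner_le: "cmod (cinner x y) \<le> norm x * norm y" for x y :: "'a::complex_inner"
proof (cases "cinner x y = 0")
  case False
  define a where "a = cnj (sgn (cinner x y))"
  have "cmod a = 1" using False by (simp add: a_def norm_sgn)
  have "a * cinner x y = of_real (cmod (cinner x y))"
    using False complex_norm_square[of "cinner x y"] unfolding a_def sgn_eq
    by (simp add: power2_eq_square field_simps)
  then have "cmod (cinner x y) = Re (cinner (a *\<^sub>C x) y)"
    by (simp add: cinner_scaleC_left)
  also have "\<dots> \<le> norm (a *\<^sub>C x) * norm y" by (rule Re_cinner_le)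
  finally show ?thesis by (simp add: norm_scaleC \<open>cmod a = 1\<close>)
qed simp

lemma bounded_bilinear_cinner: "bounded_bilinear (cinner :: 'a::complex_inner \<Rightarrow> 'a \<Rightarrow> complex)"
  by unfold_locales
    (auto simp: cinner_add_left cinner_add_right cinner_scaleR_left cinner_scaleR_right
      scaleR_conv_of_real cmod_cinner_le intro!: exI[of _ 1])

lemmas continuous_on_cinner [continuous_intros] =
  bounded_bilinear.continuous_on[OF bounded_bilinear_cinner]

lemma bounded_linear_scaleC: "bounded_linear (scaleC a :: 'a::complex_inner \<Rightarrow> 'a)"
  by (rule bounded_linear_intro[where K = "cmod a"])
    (simp_all add: scaleC_add_right scaleR_scaleC scaleC_scaleC norm_scaleC mult.commute)

lemmas continuous_on_scaleC [continuous_intros] =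
  bounded_linear.continuous_on[OF bounded_linear_scaleC]

lemma cinner_ext: "(\<And>x. cinner x y = cinner x z) \<Longrightarrow> y = z"
  using cinner_eq_zero_iff[of "y - z"] by (simp add: cinner_diff_right)


section \<open>Bounded operators and adjoints\<close>

lemma clinear_iff:
  "clinear T \<longleftrightarrow> (\<forall>x y. T (x + y) = T x + T y) \<and> (\<forall>a x. T (a *\<^sub>C x) = a *\<^sub>C T x)"
  by (auto simp: Vector_Spaces.linear_iff complex_vector.vector_space_axioms)

lemma bounded_clinear_add: "bounded_clinear T \<Longrightarrow> T (x + y) = T x + T y"
  and bounded_clinear_scaleC: "bounded_clinear T \<Longrightarrow> T (a *\<^sub>C x) = a *\<^sub>C T x"
  by (auto simp: bounded_clinear_def clinear_iff)

lemma bounded_clinear_imp_bounded_linear: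
  assumes "bounded_clinear T"
  shows "bounded_linear T"
proof -
  obtain K where "\<forall>x. norm (T x) \<le> K * norm x"
    using assms by (auto simp: bounded_clinear_def)
  then show ?thesis
    using assms
    by (intro bounded_linear_intro[where K = K])
      (auto simp: bounded_clinear_add bounded_clinear_scaleC scaleR_scaleC mult.commute)
qed

lemma bounded_clinearI:
  assumes "\<And>x y. T (x + y) = T x + T y" and "\<And>a x. T (a *\<^sub>C x) = a *\<^sub>C T x"
    and "\<And>x. norm (T x) \<le> K * norm x"
  shows "bounded_clinear T"
  using assms by (auto simp: bounded_clinear_def clinear_iff)

lemma bounded_clinear_compose:
  assumes "bounded_clinear T" and "bounded_clinear S"
  shows "bounded_clinear (T \<circ> S)"
proof -
  have "bounded_linear (T \<circ> S)"
    using assms by (auto simp: comp_def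
        intro: bounded_linear_compose bounded_clinear_imp_bounded_linear)
  then obtain K where "\<And>x. norm ((T \<circ> S) x) \<le> norm x * K"
    using bounded_linear.bounded by blast
  then show ?thesis
    using assms by (intro bounded_clinearI[where K = K])
      (auto simp: bounded_clinear_add bounded_clinear_scaleC mult.commute)
qed

text \<open>This extracts the first-order condition at a minimum without differentiating. The
  witness \<open>- b / c\<close> is the minimiser of \<open>t\<^sup>2 c + 2 t b\<close> for a \<open>c\<close> that is positive and at least \<open>a\<close>.\<close>

lemma real_quadratic_nonneg_imp_linear_zero:
  assumes "\<And>t::real. 0 \<le> t\<^sup>2 * a + 2 * t * b"
  shows "b = 0"
proof (rule ccontr)
  assume "b \<noteq> 0"
  define c where "c = \<bar>a\<bar> + 1"
  have "c > 0" by (simp add: c_def)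
  have "0 \<le> (b / c)\<^sup>2 * a + 2 * (- b / c) * b" using assms[of "- b / c"] by simp
  also have "\<dots> \<le> (b / c)\<^sup>2 * c + 2 * (- b / c) * b"
    by (intro add_right_mono mult_left_mono) (auto simp: c_def)
  also have "\<dots> = - (b\<^sup>2 / c)" using \<open>c > 0\<close> by (simp add: field_simps power2_eq_square)
  also have "\<dots> < 0" using \<open>c > 0\<close> \<open>b \<noteq> 0\<close> by simp
  finally show False by simp
qed

text \<open>The representing vector is the minimiser of \<open>\<Phi> x = \<parallel>x\<parallel>\<^sup>2 - 2 Re (f x)\<close>, which is
  \<open>\<parallel>x - z\<parallel>\<^sup>2 - \<parallel>z\<parallel>\<^sup>2\<close> for the vector \<open>z\<close> sought. By the parallelogram law a minimising sequence is
  Cauchy, and at the minimum the derivative in every direction vanishes. That gives the equality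
  of the real parts; the imaginary parts follow by testing with \<open>\<i> x\<close>.\<close>

lemma riesz_representation:
  fixes f :: "'a::chilbert_space \<Rightarrow> complex"
  assumes f: "bounded_clinear f"
  shows "\<exists>z. \<forall>x. f x = cinner x z"
proof -
  obtain K where K: "\<And>x. cmod (f x) \<le> K * norm x"
    using f by (auto simp: bounded_clinear_def)
  define g where "g x = Re (f x)" for x
  have g: "bounded_linear g"
    unfolding g_def
    by (intro bounded_linear_compose[OF bounded_linear_Re] bounded_clinear_imp_bounded_linear f)
  interpret g: bounded_linear g by (rule g)
  define \<Phi> where "\<Phi> x = (norm x)\<^sup>2 - 2 * g x" for x
  have lower: "- K\<^sup>2 \<le> \<Phi> x" for x
  proof -
    have "g x \<le> K * norm x"
      using K[of x] complex_Re_le_cmod[of "f x"] by (simp add: g_def)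
    moreover have "0 \<le> (norm x - K)\<^sup>2" by simp
    ultimately show ?thesis by (simp add: \<Phi>_def power2_eq_square algebra_simps)
  qed
  define m where "m = (INF x. \<Phi> x)"
  have bdd: "bdd_below (range \<Phi>)" using lower by (intro bdd_belowI2)
  have m_le: "m \<le> \<Phi> x" for x unfolding m_def by (rule cINF_lower[OF bdd]) simp
  have "\<exists>x. \<Phi> x < m + inverse (real (Suc n))" for n
    using cINF_less_iff[OF _ bdd, of "m + inverse (real (Suc n))"] by (auto simp: m_def)
  then obtain X where X: "\<And>n. \<Phi> (X n) < m + inverse (real (Suc n))" by metis
  \<comment> \<open>The parallelogram law, in which the linear part of \<open>\<Phi>\<close> cancels.\<close>
  have gap: "(norm (x - y))\<^sup>2 = 2 * \<Phi> x + 2 * \<Phi> y - 4 * \<Phi> ((1/2) *\<^sub>R (x + y))" for x y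
    unfolding \<Phi>_def norm_scaleR power_mult_distrib norm_add_square norm_diff_square
    by (simp add: g.add g.scaleR power2_eq_square field_simps)
  have "Cauchy X"
  proof (rule metric_CauchyI)
    fix e :: real assume "e > 0"
    then obtain N where N: "inverse (real (Suc N)) < e\<^sup>2 / 4"
      using reals_Archimedean[of "e\<^sup>2 / 4"] by auto
    have near: "\<Phi> (X n) < m + e\<^sup>2 / 4" if "n \<ge> N" for n
    proof -
      have "inverse (real (Suc n)) \<le> inverse (real (Suc N))"
        using that by (intro le_imp_inverse_le) auto
      then show ?thesis using X[of n] N by linarith
    qed
    have "dist (X i) (X j) < e" if "i \<ge> N" "j \<ge> N" for i j
    proof -
      have "(norm (X i - X j))\<^sup>2 < e\<^sup>2"
        using gap[of "X i" "X j"] near[OF that(1)] near[OF that(2)]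
          m_le[of "(1/2) *\<^sub>R (X i + X j)"] by linarith
      then show ?thesis using \<open>e > 0\<close> by (simp add: dist_norm power2_less_imp_less)
    qed
    then show "\<exists>M. \<forall>i\<ge>M. \<forall>j\<ge>M. dist (X i) (X j) < e" by blast
  qed
  then obtain z where z: "X \<longlonglongrightarrow> z"
    using Cauchy_convergent convergent_def by blast
  have "(\<lambda>n. \<Phi> (X n)) \<longlonglongrightarrow> \<Phi> z"
    unfolding \<Phi>_def by (intro tendsto_intros z g.tendsto)
  moreover have "(\<lambda>n. m + inverse (real (Suc n))) \<longlonglongrightarrow> m"
    using tendsto_add[OF tendsto_const LIMSEQ_inverse_real_of_nat] by simp
  ultimately have min: "\<Phi> z \<le> m"
    using X by (intro LIMSEQ_le[of "\<lambda>n. \<Phi> (X n)"]) (auto intro: less_imp_le)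
  have real_part: "g x = Re (cinner x z)" for x
  proof -
    have "0 \<le> t\<^sup>2 * (norm x)\<^sup>2 + 2 * t * (Re (cinner x z) - g x)" for t
    proof -
      have "\<Phi> (z + t *\<^sub>R x) - \<Phi> z = t\<^sup>2 * (norm x)\<^sup>2 + 2 * t * (Re (cinner x z) - g x)"
        unfolding \<Phi>_def norm_add_square
        by (simp add: g.add g.scaleR cinner_scaleR_right power_mult_distrib
            Re_cinner_commute[of z x] algebra_simps)
      then show ?thesis using min m_le[of "z + t *\<^sub>R x"] by linarith
    qed
    from real_quadratic_nonneg_imp_linear_zero[OF this] show ?thesis by simp
  qed
  have "f x = cinner x z" for x
  proof (rule complex_eqI)
    show "Re (f x) = Re (cinner x z)" using real_part by (simp add: g_def)
    show "Im (f x) = Im (cinner x z)"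
      using real_part[of "\<i> *\<^sub>C x"]
      by (simp add: g_def bounded_clinear_scaleC[OF f] scaleC_complex_def cinner_scaleC_left)
  qed
  then show ?thesis by blast
qed

lemma cinner_cadjoint:
  fixes T :: "'a::chilbert_space \<Rightarrow> 'b::chilbert_space"
  assumes T: "bounded_clinear T"
  shows "cinner (T x) y = cinner x (cadjoint T y)"
proof -
  obtain K where K: "\<And>x. norm (T x) \<le> K * norm x"
    using T by (auto simp: bounded_clinear_def)
  have "\<forall>y. \<exists>z. \<forall>x. cinner (T x) y = cinner x z"
  proof (rule allI, rule riesz_representation, rule bounded_clinearI)
    fix y x
    have "cmod (cinner (T x) y) \<le> norm (T x) * norm y" by (rule cmod_cinner_le)
    also have "\<dots> \<le> (K * norm x) * norm y" by (intro mult_right_mono K) simp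
    finally show "norm (cinner (T x) y) \<le> (K * norm y) * norm x" by (simp add: ac_simps)
  qed (simp_all add: bounded_clinear_add[OF T] bounded_clinear_scaleC[OF T]
      cinner_add_left cinner_scaleC_left scaleC_complex_def)
  from choice[OF this] obtain S where S: "\<forall>x y. cinner (T x) y = cinner x (S y)" by blast
  moreover have "S' = S" if "\<forall>x y. cinner (T x) y = cinner x (S' y)" for S'
  proof (rule ext, rule cinner_ext)
    fix y x show "cinner x (S' y) = cinner x (S y)"
      by (rule trans[OF sym[OF that[rule_format]] S[rule_format]])
  qed
  ultimately have "\<forall>x y. cinner (T x) y = cinner x (cadjoint T y)"
    unfolding cadjoint_def by (rule theI)
  then show ?thesis by blast
qed

lemma bounded_clinear_cadjoint:
  fixes T :: "'a::chilbert_space \<Rightarrow> 'b::chilbert_space"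
  assumes T: "bounded_clinear T"
  shows "bounded_clinear (cadjoint T)"
proof -
  obtain K where "0 \<le> K" and K: "\<And>x. norm (T x) \<le> norm x * K"
    using bounded_linear.nonneg_bounded[OF bounded_clinear_imp_bounded_linear[OF T]] by blast
  note adj = cinner_cadjoint[OF T, symmetric]
  show ?thesis
  proof (rule bounded_clinearI[where K = K])
    fix y
    have "(norm (cadjoint T y))\<^sup>2 = Re (cinner (T (cadjoint T y)) y)"
      by (simp add: Re_cinner_self flip: adj)
    also have "\<dots> \<le> norm (T (cadjoint T y)) * norm y" by (rule Re_cinner_le)
    also have "\<dots> \<le> (norm (cadjoint T y) * K) * norm y" by (intro mult_right_mono K) simp
    finally have "norm (cadjoint T y) * norm (cadjoint T y) \<le> norm (cadjoint T y) * (K * norm y)"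
      by (simp add: power2_eq_square ac_simps)
    then show "norm (cadjoint T y) \<le> K * norm y"
      using \<open>0 \<le> K\<close> by (cases "norm (cadjoint T y) = 0") (auto simp: mult_le_cancel_left)
  qed (rule cinner_ext, simp add: adj cinner_add_right cinner_scaleC_right)+
qed

section \<open>Numerical radius of a bounded operator\<close>

text \<open>At \<open>x = 0\<close> both sides vanish whatever the value of the numerical radius, so the zero space
  is covered although the supremum that defines the radius there is over the empty set.\<close>

lemma cmod_cinner_le_numerical_radius:
  fixes T :: "'a::chilbert_space \<Rightarrow> 'a"
  assumes T: "bounded_clinear T"
  shows "cmod (cinner (T x) x) \<le> numerical_radius T * (norm x)\<^sup>2"
proof (cases "x = 0")
  case False
  obtain K where K: "\<And>x. norm (T x) \<le> K * norm x"
    using T by (auto simp: bounded_clinear_def)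
  have bdd: "bdd_above ((\<lambda>x. cmod (cinner (T x) x)) ` {x. norm x = 1})"
  proof (rule bdd_aboveI2)
    fix x :: 'a assume "x \<in> {x. norm x = 1}"
    then show "cmod (cinner (T x) x) \<le> K"
      using cmod_cinner_le[of "T x" x] K[of x] by simp
  qed
  define r where "r = inverse (norm x)"
  have "T (r *\<^sub>R x) = r *\<^sub>R T x"
    using T by (simp add: scaleR_scaleC bounded_clinear_scaleC)
  then have "r\<^sup>2 * cmod (cinner (T x) x) = cmod (cinner (T (r *\<^sub>R x)) (r *\<^sub>R x))"
    by (simp add: cinner_scaleR_left cinner_scaleR_right norm_mult power2_eq_square)
  also have "\<dots> \<le> numerical_radius T"
    unfolding numerical_radius_def
    using False by (intro cSUP_upper[OF _ bdd]) (simp add: r_def)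
  finally show ?thesis
    using False by (simp add: r_def field_simps)
qed simp

text \<open>Polarisation: for self-adjoint \<open>H\<close>, \<open>4 Re \<langle>H x, y\<rangle>\<close> is the difference of the quadratic form at
  \<open>x + y\<close> and \<open>x - y\<close>, hence by the parallelogram law at most \<open>2 M (\<parallel>x\<parallel>\<^sup>2 + \<parallel>y\<parallel>\<^sup>2)\<close>. The best choice of
  \<open>y\<close> is the multiple of \<open>H x\<close> that has the norm of \<open>x\<close>.\<close>

lemma self_adjoint_norm_le:
  fixes H :: "'a::complex_inner \<Rightarrow> 'a"
  assumes H: "linear H" and adj: "\<And>x y. cinner (H x) y = cinner x (H y)"
    and M: "\<And>x. \<bar>Re (cinner (H x) x)\<bar> \<le> M * (norm x)\<^sup>2"
  shows "norm (H x) \<le> M * norm x"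
proof (cases "H x = 0")
  case True
  have "M \<ge> 0" if "x \<noteq> 0"
  proof -
    have "0 \<le> M * (norm x)\<^sup>2" using M[of x] by linarith
    then show ?thesis using that by (simp add: zero_le_mult_iff)
  qed
  then show ?thesis using True by (cases "x = 0") auto
next
  case False
  interpret H: linear H by (rule H)
  have "x \<noteq> 0" using False H.zero by auto
  define c where "c = norm x / norm (H x)"
  define y where "y = c *\<^sub>R H x"
  have [simp]: "norm y = norm x" using False by (simp add: y_def c_def)
  have "4 * Re (cinner (H x) y) =
      Re (cinner (H (x + y)) (x + y)) - Re (cinner (H (x - y)) (x - y))"
    by (simp add: H.add H.diff cinner_add_left cinner_add_right cinner_diff_left cinner_diff_right
        adj[of y x] Re_cinner_commute[of y "H x"])
  also have "\<dots> \<le> M * (norm (x + y))\<^sup>2 + M * (norm (x - y))\<^sup>2"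
    using M[of "x + y"] M[of "x - y"] by linarith
  also have "\<dots> = 4 * (M * (norm x)\<^sup>2)"
    unfolding norm_add_square norm_diff_square by (simp add: algebra_simps)
  finally have "Re (cinner (H x) y) \<le> M * (norm x)\<^sup>2" by simp
  moreover have "Re (cinner (H x) y) = norm x * norm (H x)"
    using False by (simp add: y_def c_def cinner_scaleR_right Re_cinner_self power2_eq_square)
  ultimately have "norm x * norm (H x) \<le> norm x * (M * norm x)"
    by (simp add: power2_eq_square ac_simps)
  then show ?thesis using \<open>x \<noteq> 0\<close> by (simp add: mult_le_cancel_left)
qed

text \<open>The operator \<open>u T + (u T)\<^sup>*\<close> is self-adjoint with quadratic form \<open>2 Re (u \<langle>T x, x\<rangle>)\<close>. The
  choice \<open>u = 1\<close> gives \<open>T + T\<^sup>*\<close>, and \<open>u = \<i>\<close> gives \<open>\<i> (T - T\<^sup>*)\<close>, so that one lemma bounds both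
  norms in the lower bound.\<close>

lemma norm_rotated_real_part_le:
  fixes T S :: "'a::chilbert_space \<Rightarrow> 'a"
  assumes T: "bounded_clinear T" and S: "bounded_clinear S"
    and adj: "\<And>x y. cinner (T x) y = cinner x (S y)" and u: "cmod u = 1"
  shows "norm (u *\<^sub>C T x + cnj u *\<^sub>C S x) \<le> 2 * numerical_radius T * norm x"
proof (rule self_adjoint_norm_le)
  have adj': "cinner (S x) y = cinner x (T y)" for x y
    by (metis adj cinner_commute)
  show "linear (\<lambda>x. u *\<^sub>C T x + cnj u *\<^sub>C S x)"
    by (intro bounded_linear.linear bounded_linear_add bounded_linear_compose[OF bounded_linear_scaleC]
        bounded_clinear_imp_bounded_linear T S)
  show "cinner (u *\<^sub>C T x + cnj u *\<^sub>C S x) y = cinner x (u *\<^sub>C T y + cnj u *\<^sub>C S y)" for x y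
    by (simp add: cinner_add_left cinner_add_right cinner_scaleC_left cinner_scaleC_right adj adj')
  fix x
  have "cnj u * cinner (S x) x = cnj (u * cinner (T x) x)"
    unfolding adj' by (subst cinner_commute) simp
  then have "Re (cinner (u *\<^sub>C T x + cnj u *\<^sub>C S x) x) = 2 * Re (u * cinner (T x) x)"
    by (simp only: cinner_add_left cinner_scaleC_left complex_add_cnj Re_complex_of_real)
  then have "\<bar>Re (cinner (u *\<^sub>C T x + cnj u *\<^sub>C S x) x)\<bar> \<le> 2 * cmod (cinner (T x) x)"
    using abs_Re_le_cmod[of "u * cinner (T x) x"] u by (simp add: norm_mult)
  then show "\<bar>Re (cinner (u *\<^sub>C T x + cnj u *\<^sub>C S x) x)\<bar> \<le> 2 * numerical_radius T * (norm x)\<^sup>2"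
    using cmod_cinner_le_numerical_radius[OF T, of x] by simp
qed

text \<open>Twice the anticommutator is \<open>(T + S)\<^sup>2 - (T - S)\<^sup>2\<close>.\<close>

lemma norm_anticommutator_le:
  fixes T S :: "'a::real_normed_vector \<Rightarrow> 'a"
  assumes T: "bounded_linear T" and S: "bounded_linear S"
  shows "onorm (\<lambda>v. S (T v) + T (S v))
    \<le> ((onorm (\<lambda>v. T v + S v))\<^sup>2 + (onorm (\<lambda>v. T v - S v))\<^sup>2) / 2" (is "_ \<le> (?p\<^sup>2 + ?q\<^sup>2) / 2")
proof (rule onorm_bound)
  interpret T: bounded_linear T by (rule T)
  interpret S: bounded_linear S by (rule S)
  have P: "bounded_linear (\<lambda>v. T v + S v)" and Q: "bounded_linear (\<lambda>v. T v - S v)"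
    by (intro bounded_linear_add bounded_linear_sub T S)+
  fix v
  let ?P2 = "T (T v + S v) + S (T v + S v)" and ?Q2 = "T (T v - S v) - S (T v - S v)"
  have "norm ?P2 \<le> ?p * norm (T v + S v)" by (rule onorm[OF P])
  also have "\<dots> \<le> ?p * (?p * norm v)" by (intro mult_left_mono onorm[OF P] onorm_pos_le[OF P])
  finally have p: "norm ?P2 \<le> ?p\<^sup>2 * norm v" by (simp add: power2_eq_square mult.assoc)
  have "norm ?Q2 \<le> ?q * norm (T v - S v)" by (rule onorm[OF Q])
  also have "\<dots> \<le> ?q * (?q * norm v)" by (intro mult_left_mono onorm[OF Q] onorm_pos_le[OF Q])
  finally have q: "norm ?Q2 \<le> ?q\<^sup>2 * norm v" by (simp add: power2_eq_square mult.assoc)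
  have "2 *\<^sub>R (S (T v) + T (S v)) = ?P2 - ?Q2"
    by (simp add: T.add S.add T.diff S.diff scaleR_2)
  then have "2 * norm (S (T v) + T (S v)) = norm (?P2 - ?Q2)"
    by (metis abs_numeral norm_scaleR)
  also have "\<dots> \<le> norm ?P2 + norm ?Q2" by (rule norm_triangle_ineq4)
  finally show "norm (S (T v) + T (S v)) \<le> (?p\<^sup>2 + ?q\<^sup>2) / 2 * norm v"
    using p q by (simp add: algebra_simps)
qed simp

text \<open>The anticommutator bound turns the left-hand side into \<open>max (p\<^sup>2) (q\<^sup>2) / 4\<close>, with \<open>p\<close> and
  \<open>q\<close> the norms of \<open>T + S\<close> and \<open>T - S\<close>, and on a nonzero space both of these are at most
  twice the numerical radius.\<close>

proposition numerical_radius_square_ge: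
  fixes T S :: "'a::chilbert_space \<Rightarrow> 'a"
  assumes T: "bounded_clinear T" and S: "bounded_clinear S"
    and adj: "\<And>x y. cinner (T x) y = cinner x (S y)"
  shows "onorm (\<lambda>v. S (T v) + T (S v)) / 4
      + \<bar>(onorm (\<lambda>v. T v + S v))\<^sup>2 - (onorm (\<lambda>v. T v - S v))\<^sup>2\<bar> / 8
    \<le> (numerical_radius T)\<^sup>2"
    (is "?a / 4 + \<bar>?p\<^sup>2 - ?q\<^sup>2\<bar> / 8 \<le> _")
proof -
  note bl = bounded_clinear_imp_bounded_linear[OF T] bounded_clinear_imp_bounded_linear[OF S]
  have a: "?a \<le> (?p\<^sup>2 + ?q\<^sup>2) / 2" by (rule norm_anticommutator_le[OF bl])
  have p0: "?p \<ge> 0" and q0: "?q \<ge> 0"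
    by (intro onorm_pos_le bounded_linear_add bounded_linear_sub bl)+
  have "?p\<^sup>2 / 4 \<le> (numerical_radius T)\<^sup>2 \<and> ?q\<^sup>2 / 4 \<le> (numerical_radius T)\<^sup>2"
  proof (cases "\<exists>x::'a. x \<noteq> 0")
    case True
    then obtain x :: 'a where "x \<noteq> 0" ..
    have "0 \<le> numerical_radius T * (norm x)\<^sup>2"
      using cmod_cinner_le_numerical_radius[OF T, of x] order_trans norm_ge_zero by blast
    then have w: "0 \<le> numerical_radius T" using \<open>x \<noteq> 0\<close> by (simp add: zero_le_mult_iff)
    have "?p \<le> 2 * numerical_radius T"
      using norm_rotated_real_part_le[OF T S adj, of 1] w
      by (intro onorm_bound) (simp_all add: scaleC_one)
    moreover have "?q \<le> 2 * numerical_radius T"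
    proof (rule onorm_bound)
      fix x
      have "\<i> *\<^sub>C T x + cnj \<i> *\<^sub>C S x = \<i> *\<^sub>C (T x - S x)"
        by (simp add: complex_vector.scale_right_diff_distrib)
      then show "norm (T x - S x) \<le> 2 * numerical_radius T * norm x"
        using norm_rotated_real_part_le[OF T S adj, of \<i> x] by (simp add: norm_scaleC)
    qed (use w in simp)
    ultimately have "?p\<^sup>2 \<le> (2 * numerical_radius T)\<^sup>2" "?q\<^sup>2 \<le> (2 * numerical_radius T)\<^sup>2"
      using p0 q0 by (blast intro: power_mono)+
    then show ?thesis by (simp add: power_mult_distrib)
  next
    case False
    \<comment> \<open>On the zero space the numerical radius is an arbitrary real, but all operator norms vanish.\<close>
    then have "norm x = 0" for x :: 'a by simp
    then have "?p \<le> 0" "?q \<le> 0" by (intro onorm_bound; simp)+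
    then show ?thesis using p0 q0 by simp
  qed
  then show ?thesis using a by argo
qed

section \<open>Operators on the tensor product\<close>

text \<open>A map given by representatives is best described by its graph \<open>G\<close>: if the graph is linear
  and bounded, then a pair \<open>(0, w)\<close> in it has \<open>w = 0\<close>, so \<open>G\<close> is single-valued. The resulting map is
  Lipschitz, hence extends continuously to the closure of its domain, and linearity and the bound
  are closed conditions that pass to the extension.\<close>

lemma dense_relation_extends_to_bounded_clinear:
  fixes G :: "'t::complex_inner \<Rightarrow> 'u::chilbert_space \<Rightarrow> bool"
  assumes add: "\<And>v w v' w'. G v w \<Longrightarrow> G v' w' \<Longrightarrow> G (v + v') (w + w')"
    and scale: "\<And>a v w. G v w \<Longrightarrow> G (a *\<^sub>C v) (a *\<^sub>C w)"
    and bound: "\<And>v w. G v w \<Longrightarrow> norm w \<le> K * norm v"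
    and dense: "closure {v. \<exists>w. G v w} = UNIV"
  shows "\<exists>T. bounded_clinear T \<and> (\<forall>v w. G v w \<longrightarrow> T v = w)"
proof -
  define D where "D = {v. \<exists>w. G v w}"
  have diff: "norm (w - w') \<le> K * norm (v - v')" if "G v w" "G v' w'" for v w v' w'
    using bound[OF add[OF that(1) scale[OF that(2), of "- 1"]]]
    by (simp add: complex_vector.scale_minus_left scaleC_one)
  have unique: "w' = w" if "G v w" "G v w'" for v w w'
    using diff[OF that] by simp
  define f where "f v = (THE w. G v w)" for v
  have f: "f v = w" if "G v w" for v w
    unfolding f_def using that by (rule the_equality) (rule unique[OF that])
  have Gf: "G v (f v)" if "v \<in> D" for v
    using that f by (auto simp: D_def)
  have "uniformly_continuous_on D f"
    unfolding uniformly_continuous_on_def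
  proof (intro allI impI)
    fix e :: real assume "e > 0"
    have "dist (f v') (f v) < e" if "v \<in> D" "v' \<in> D" "dist v' v < e / (\<bar>K\<bar> + 1)" for v v'
    proof -
      have "norm (f v' - f v) \<le> K * norm (v' - v)" using diff Gf that by blast
      also have "\<dots> \<le> (\<bar>K\<bar> + 1) * norm (v' - v)" by (intro mult_right_mono) auto
      also have "\<dots> < e" using that(3) by (simp add: dist_norm field_simps)
      finally show ?thesis by (simp add: dist_norm)
    qed
    then show "\<exists>d>0. \<forall>x\<in>D. \<forall>x'\<in>D. dist x' x < d \<longrightarrow> dist (f x') (f x) < e"
      using \<open>e > 0\<close> by (intro exI[of _ "e / (\<bar>K\<bar> + 1)"]) (auto simp: field_simps)
  qed
  then obtain T where "uniformly_continuous_on (closure D) T" and T: "\<And>v. v \<in> D \<Longrightarrow> f v = T v"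
    using uniformly_continuous_on_extension_on_closure by metis
  then have cont: "continuous_on UNIV T"
    using dense by (simp add: D_def uniformly_continuous_imp_continuous)
  have GT: "G v (T v)" if "v \<in> D" for v using Gf[OF that] T[OF that] by simp
  have T_eq: "T v = w" if "G v w" for v w
  proof -
    have "v \<in> D" using that by (auto simp: D_def)
    then show ?thesis using f[OF that] T by simp
  qed
  have cont_fst: "continuous_on UNIV (\<lambda>p :: 't \<times> 't. T (fst p))"
    and cont_snd: "continuous_on UNIV (\<lambda>p :: 't \<times> 't. T (snd p))"
    and cont_sum: "continuous_on UNIV (\<lambda>p :: 't \<times> 't. T (fst p + snd p))"
    by (rule continuous_on_compose2[OF cont], intro continuous_intros, simp)+
  have "bounded_clinear T"
  proof (rule bounded_clinearI[where K = K])
    have "closure (D \<times> D) \<subseteq> {p. T (fst p + snd p) = T (fst p) + T (snd p)}"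
    proof (rule closure_minimal)
      show "D \<times> D \<subseteq> {p. T (fst p + snd p) = T (fst p) + T (snd p)}"
        using add GT T_eq by fastforce
      show "closed {p. T (fst p + snd p) = T (fst p) + T (snd p)}"
        by (intro closed_Collect_eq continuous_intros cont_fst cont_snd cont_sum)
    qed
    moreover have "(x, y) \<in> closure (D \<times> D)" for x y
      using dense by (simp add: closure_Times D_def)
    ultimately show "T (x + y) = T x + T y" for x y by fastforce
    fix a
    have cont_scale: "continuous_on UNIV (\<lambda>v. T (a *\<^sub>C v))"
      by (rule continuous_on_compose2[OF cont], intro continuous_intros, simp)
    have "closure D \<subseteq> {v. T (a *\<^sub>C v) = a *\<^sub>C T v}"
    proof (rule closure_minimal)
      show "D \<subseteq> {v. T (a *\<^sub>C v) = a *\<^sub>C T v}"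
        using scale GT T_eq by fastforce
      show "closed {v. T (a *\<^sub>C v) = a *\<^sub>C T v}"
        by (intro closed_Collect_eq continuous_intros cont cont_scale)
    qed
    then show "T (a *\<^sub>C v) = a *\<^sub>C T v" for v using dense by (auto simp: D_def)
  next
    have "closure D \<subseteq> {v. norm (T v) \<le> K * norm v}"
    proof (rule closure_minimal)
      show "D \<subseteq> {v. norm (T v) \<le> K * norm v}" using bound GT by blast
      show "closed {v. norm (T v) \<le> K * norm v}"
        by (intro closed_Collect_le continuous_intros cont)
    qed
    then show "norm (T v) \<le> K * norm v" for v using dense by (auto simp: D_def)
  qed
  then show ?thesis using T_eq by blast
qed

lemma
  assumes "hilbert_tensor_product tens"
  shows tensor_add_left: "tens (x + x') y = tens x y + tens x' y"
    and tensor_add_right: "tens x (y + y') = tens x y + tens x y'"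
    and tensor_scaleC_left: "tens (a *\<^sub>C x) y = a *\<^sub>C tens x y"
    and tensor_scaleC_right: "tens x (a *\<^sub>C y) = a *\<^sub>C tens x y"
    and cinner_tensor: "cinner (tens x y) (tens x' y') = cinner x x' * cinner y y'"
    and tensor_span_dense: "closure (cspan {tens x y |x y. True}) = UNIV"
  using assms by (auto simp: hilbert_tensor_product_def clinear_iff)

lemma hilbert_tensor_product_swap:
  assumes "hilbert_tensor_product tens"
  shows "hilbert_tensor_product (\<lambda>y x. tens x y)"
proof -
  have "{tens x y |y x. True} = {tens x y |x y. True}" by auto
  then show ?thesis using assms by (auto simp: hilbert_tensor_product_def)
qed

text \<open>The density of the span of the elementary tensors, in the form of an induction rule.\<close>

lemma hilbert_tensor_induct [consumes 1, case_names closed zero add scale tensor]: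
  assumes tens: "hilbert_tensor_product tens"
    and closed: "closed {v. P v}"
    and zero: "P 0" and add: "\<And>v w. P v \<Longrightarrow> P w \<Longrightarrow> P (v + w)"
    and scale: "\<And>a v. P v \<Longrightarrow> P (a *\<^sub>C v)"
    and tensor: "\<And>x y. P (tens x y)"
  shows "P v"
proof -
  have "cspan {tens x y |x y. True} \<subseteq> {v. P v}"
    by (rule complex_vector.span_minimal)
      (auto simp: complex_vector.subspace_def zero add scale tensor)
  then have "closure (cspan {tens x y |x y. True}) \<subseteq> {v. P v}"
    by (rule closure_minimal) (rule closed)
  then show ?thesis using tensor_span_dense[OF tens] by auto
qed

lemma bounded_clinear_eq_on_tensors:
  assumes "hilbert_tensor_product tens" and S: "bounded_clinear S" and T: "bounded_clinear T"
    and "\<And>x y. S (tens x y) = T (tens x y)"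
  shows "S = T"
proof
  fix v
  note bl = bounded_clinear_imp_bounded_linear[OF S] bounded_clinear_imp_bounded_linear[OF T]
  show "S v = T v"
    using assms(1)
  proof (induction v rule: hilbert_tensor_induct)
    case closed
    show ?case by (intro closed_Collect_eq bl[THEN bounded_linear.continuous_on] continuous_on_id)
  qed (simp_all add: assms(4) bounded_clinear_add[OF S] bounded_clinear_add[OF T]
      bounded_clinear_scaleC[OF S] bounded_clinear_scaleC[OF T]
      bl[THEN bounded_linear.linear, THEN linear_0])
qed

text \<open>The graph of \<open>A \<otimes> I\<close> on the algebraic tensor product: the pairs
  \<open>(\<Sum> x\<^sub>i \<otimes> y\<^sub>i, \<Sum> A x\<^sub>i \<otimes> y\<^sub>i)\<close>. Building both sums along the same list of terms avoids having to
  know beforehand that the second depends only on the first.\<close>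

inductive left_tensor_graph ::
    "('h::chilbert_space \<Rightarrow> 'k::chilbert_space \<Rightarrow> 't::chilbert_space) \<Rightarrow> ('h \<Rightarrow> 'h) \<Rightarrow> 't \<Rightarrow> 't \<Rightarrow> bool"
  for tens A where
  zero: "left_tensor_graph tens A 0 0"
| step: "left_tensor_graph tens A v w
    \<Longrightarrow> left_tensor_graph tens A (v + tens x y) (w + tens (A x) y)"

definition orthonormal :: "'a::complex_inner set \<Rightarrow> bool" where
  "orthonormal E \<longleftrightarrow> (\<forall>e\<in>E. \<forall>e'\<in>E. cinner e e' = (if e = e' then 1 else 0))"

lemma left_tensor_graph_add:
  assumes "left_tensor_graph tens A v w" and "left_tensor_graph tens A v' w'"
  shows "left_tensor_graph tens A (v + v') (w + w')"
  using assms(2)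
proof induction
  case (step v' w' x y)
  show ?case
    using left_tensor_graph.step[OF step.IH, of x y] by (simp add: add.assoc)
qed (simp add: assms(1))

lemma left_tensor_graph_scaleC:
  assumes tens: "hilbert_tensor_product tens" and A: "bounded_clinear A"
    and "left_tensor_graph tens A v w"
  shows "left_tensor_graph tens A (a *\<^sub>C v) (a *\<^sub>C w)"
  using assms(3)
proof induction
  case (step v w x y)
  show ?case
    using left_tensor_graph.step[OF step.IH, of "a *\<^sub>C x" y]
    by (simp add: scaleC_add_right tensor_scaleC_left[OF tens] bounded_clinear_scaleC[OF A])
qed (simp add: left_tensor_graph.zero)

text \<open>Gram--Schmidt on the second legs, carried out simultaneously in both components. To add
  \<open>x \<otimes> y\<close>, split \<open>y\<close> into its projection \<open>p\<close> onto the span of the vectors \<open>e\<close> at hand and the remainder \<open>r\<close>.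
  The part \<open>x \<otimes> p\<close> only changes the first legs, by multiples of \<open>x\<close>, which \<open>A\<close> respects. A nonzero
  \<open>r\<close> is normalised and joins the orthonormal set.\<close>

lemma left_tensor_graph_orthonormal:
  assumes tens: "hilbert_tensor_product tens" and A: "bounded_clinear A"
    and "left_tensor_graph tens A v w"
  shows "\<exists>E f. finite E \<and> orthonormal E \<and>
    v = (\<Sum>e\<in>E. tens (f e) e) \<and> w = (\<Sum>e\<in>E. tens (A (f e)) e)"
  using assms(3)
proof induction
  case zero
  show ?case by (intro exI[of _ "{}"]) (simp add: orthonormal_def)
next
  case (step v w x y)
  then obtain E f where E: "finite E" "orthonormal E"
    and v: "v = (\<Sum>e\<in>E. tens (f e) e)" and w: "w = (\<Sum>e\<in>E. tens (A (f e)) e)" by blast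
  note tadd = tensor_add_left[OF tens] tensor_add_right[OF tens]
    and tscale = tensor_scaleC_left[OF tens] tensor_scaleC_right[OF tens]
    and Alin = bounded_clinear_add[OF A] bounded_clinear_scaleC[OF A]
  define p where "p = (\<Sum>e\<in>E. cinner y e *\<^sub>C e)"
  define r where "r = y - p"
  define f1 where "f1 e = f e + cinner y e *\<^sub>C x" for e
  have tsum: "tens z (sum g E) = (\<Sum>e\<in>E. tens z (g e))" for z g
    using E(1) by (induction E) (use tensor_scaleC_right[OF tens, of z 0 0] in \<open>simp_all add: tadd\<close>)
  have y: "y = p + r" by (simp add: r_def)
  have v1: "v + tens x y = (\<Sum>e\<in>E. tens (f1 e) e) + tens x r"
    by (simp add: y tadd) (simp add: v p_def tsum f1_def tadd tscale sum.distrib)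
  have w1: "w + tens (A x) y = (\<Sum>e\<in>E. tens (A (f1 e)) e) + tens (A x) r"
    by (simp add: y tadd) (simp add: w p_def tsum f1_def tadd tscale Alin sum.distrib)
  have r_orth: "cinner r e = 0" if "e \<in> E" for e
  proof -
    have "cinner p e = (\<Sum>e'\<in>E. if e' = e then cinner y e else 0)"
      unfolding p_def cinner_sum_left
      using E(2) that by (intro sum.cong) (auto simp: orthonormal_def cinner_scaleC_left)
    then show ?thesis using E(1) that by (simp add: r_def cinner_diff_left)
  qed
  show ?case
  proof (cases "r = 0")
    case True
    have "tens z 0 = 0" for z using tensor_scaleC_right[OF tens, of z 0 0] by simp
    then show ?thesis using E v1 w1 True by (intro exI[of _ E] exI[of _ f1]) simp
  next
    case False
    define n where "n = complex_of_real (norm r)"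
    have "n \<noteq> 0" using False by (simp add: n_def)
    define e where "e = inverse n *\<^sub>C r"
    have e_orth: "cinner e e' = 0" "cinner e' e = 0" if "e' \<in> E" for e'
      using r_orth[OF that] cinner_commute[of e' r]
      by (simp_all add: e_def cinner_scaleC_left cinner_scaleC_right)
    have e_norm: "cinner e e = 1"
      using False unfolding e_def cinner_scaleC_left cinner_scaleC_right cinner_self[of r]
      by (simp add: n_def power2_eq_square field_simps)
    then have "e \<notin> E" using e_orth by auto
    define f2 where "f2 = f1(e := n *\<^sub>C x)"
    have r: "r = n *\<^sub>C e" using \<open>n \<noteq> 0\<close> by (simp add: e_def scaleC_scaleC scaleC_one)
    have old: "(\<Sum>e'\<in>E. tens (f2 e') e') = (\<Sum>e'\<in>E. tens (f1 e') e')"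
      "(\<Sum>e'\<in>E. tens (A (f2 e')) e') = (\<Sum>e'\<in>E. tens (A (f1 e')) e')"
      using \<open>e \<notin> E\<close> by (auto simp: f2_def intro!: sum.cong)
    have "orthonormal (insert e E)"
      using E(2) e_orth e_norm \<open>e \<notin> E\<close> by (auto simp: orthonormal_def)
    moreover have "v + tens x y = (\<Sum>e'\<in>insert e E. tens (f2 e') e')"
      using E(1) \<open>e \<notin> E\<close> by (simp add: v1 old) (simp add: r f2_def tscale)
    moreover have "w + tens (A x) y = (\<Sum>e'\<in>insert e E. tens (A (f2 e')) e')"
      using E(1) \<open>e \<notin> E\<close> by (simp add: w1 old) (simp add: r f2_def tscale Alin)
    ultimately show ?thesis using E(1) by (metis finite_insert)
  qed
qed

lemma norm_square_orthonormal_tensor_sum: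
  assumes tens: "hilbert_tensor_product tens" and "finite E" and "orthonormal E"
  shows "(norm (\<Sum>e\<in>E. tens (f e) e))\<^sup>2 = (\<Sum>e\<in>E. (norm (f e))\<^sup>2)"
proof -
  have "cinner (\<Sum>e\<in>E. tens (f e) e) (\<Sum>e\<in>E. tens (f e) e)
      = (\<Sum>e\<in>E. \<Sum>e'\<in>E. if e' = e then cinner (f e) (f e) else 0)"
    unfolding cinner_sum_left cinner_sum_right cinner_tensor[OF tens]
    using \<open>orthonormal E\<close> by (intro sum.cong refl) (auto simp: orthonormal_def)
  also have "\<dots> = (\<Sum>e\<in>E. cinner (f e) (f e))"
    using \<open>finite E\<close> by simp
  finally show ?thesis
    unfolding Re_cinner_self[symmetric] by (simp only: Re_sum)
qed

lemma left_tensor_graph_norm_le: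
  assumes tens: "hilbert_tensor_product tens" and A: "bounded_clinear A"
    and K: "\<And>x. norm (A x) \<le> norm x * K" and "0 \<le> K"
    and G: "left_tensor_graph tens A v w"
  shows "norm w \<le> K * norm v"
proof -
  obtain E f where E: "finite E" "orthonormal E"
    and v: "v = (\<Sum>e\<in>E. tens (f e) e)" and w: "w = (\<Sum>e\<in>E. tens (A (f e)) e)"
    using left_tensor_graph_orthonormal[OF tens A G] by blast
  have "(norm w)\<^sup>2 = (\<Sum>e\<in>E. (norm (A (f e)))\<^sup>2)"
    unfolding w by (rule norm_square_orthonormal_tensor_sum[OF tens E])
  also have "\<dots> \<le> (\<Sum>e\<in>E. (K * norm (f e))\<^sup>2)"
    using K by (intro sum_mono power_mono) (auto simp: mult.commute)
  also have "\<dots> = (K * norm v)\<^sup>2"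
    unfolding v power_mult_distrib norm_square_orthonormal_tensor_sum[OF tens E] sum_distrib_left ..
  finally show ?thesis
    by (rule power2_le_imp_le) (simp add: \<open>0 \<le> K\<close>)
qed

text \<open>The operator is \<open>A \<otimes> I\<close>. It extends the graph above, whose domain contains all elementary
  tensors and is a subspace, hence is dense.\<close>

lemma ex_left_tensor_op:
  fixes tens :: "'h::chilbert_space \<Rightarrow> 'k::chilbert_space \<Rightarrow> 't::chilbert_space"
  assumes tens: "hilbert_tensor_product tens" and A: "bounded_clinear A"
  shows "\<exists>L. bounded_clinear L \<and> (\<forall>x y. L (tens x y) = tens (A x) y)"
proof -
  let ?G = "left_tensor_graph tens A"
  obtain K where K: "0 \<le> K" "\<And>x. norm (A x) \<le> norm x * K"
    using bounded_linear.nonneg_bounded[OF bounded_clinear_imp_bounded_linear[OF A]] by blast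
  have elem: "?G (tens x y) (tens (A x) y)" for x y
    using left_tensor_graph.step[OF left_tensor_graph.zero, of tens A x y] by simp
  have "cspan {tens x y |x y. True} \<subseteq> {v. \<exists>w. ?G v w}"
    by (rule complex_vector.span_minimal)
      (auto simp: complex_vector.subspace_def intro: elem left_tensor_graph.zero
        left_tensor_graph_add left_tensor_graph_scaleC[OF tens A])
  then have "closure {v. \<exists>w. ?G v w} = UNIV"
    using closure_mono tensor_span_dense[OF tens] by blast
  then have "\<exists>L. bounded_clinear L \<and> (\<forall>v w. ?G v w \<longrightarrow> L v = w)"
    using left_tensor_graph_add left_tensor_graph_scaleC[OF tens A]
      left_tensor_graph_norm_le[OF tens A K(2) K(1)]
    by (intro dense_relation_extends_to_bounded_clinear)
  then show ?thesis using elem by blast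
qed

text \<open>\<open>A \<otimes> B\<close> is the composition of \<open>A \<otimes> I\<close> and \<open>I \<otimes> B\<close>; the latter is a left operator for the
  tensor product with exchanged factors.\<close>

lemma
  fixes tens :: "'h::chilbert_space \<Rightarrow> 'k::chilbert_space \<Rightarrow> 't::chilbert_space"
  assumes tens: "hilbert_tensor_product tens" and A: "bounded_clinear A" and B: "bounded_clinear B"
  shows bounded_clinear_tensor_op: "bounded_clinear (tensor_op tens A B)"
    and tensor_op_tensor: "tensor_op tens A B (tens x y) = tens (A x) (B y)"
proof -
  obtain L where L: "bounded_clinear L" "\<And>x y. L (tens x y) = tens (A x) y"
    using ex_left_tensor_op[OF tens A] by blast
  obtain R where R: "bounded_clinear R" "\<And>x y. R (tens x y) = tens x (B y)"
    using ex_left_tensor_op[OF hilbert_tensor_product_swap[OF tens] B] by blast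
  have "\<exists>!T. bounded_clinear T \<and> (\<forall>x y. T (tens x y) = tens (A x) (B y))"
  proof (rule ex1I[of _ "L \<circ> R"])
    show "bounded_clinear (L \<circ> R) \<and> (\<forall>x y. (L \<circ> R) (tens x y) = tens (A x) (B y))"
      using L R by (simp add: bounded_clinear_compose)
    show "T = L \<circ> R" if "bounded_clinear T \<and> (\<forall>x y. T (tens x y) = tens (A x) (B y))" for T
      using that L R by (intro bounded_clinear_eq_on_tensors[OF tens])
        (auto simp: bounded_clinear_compose)
  qed
  from theI'[OF this] show "bounded_clinear (tensor_op tens A B)"
    and "tensor_op tens A B (tens x y) = tens (A x) (B y)"
    by (auto simp: tensor_op_def)
qed

lemma tensor_op_comp:
  assumes tens: "hilbert_tensor_product tens"
    and "bounded_clinear A" "bounded_clinear B" "bounded_clinear C" "bounded_clinear D"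
  shows "tensor_op tens (A \<circ> C) (B \<circ> D) = tensor_op tens A B \<circ> tensor_op tens C D"
  using assms by (intro bounded_clinear_eq_on_tensors[OF tens])
    (simp_all add: bounded_clinear_tensor_op bounded_clinear_compose tensor_op_tensor)

text \<open>Both sides are continuous and sesquilinear, so it suffices to compare them on pairs of
  elementary tensors, where the inner product factorises. The second argument is kept elementary
  while the first becomes general.\<close>

lemma cinner_tensor_op_cadjoint:
  assumes tens: "hilbert_tensor_product tens" and A: "bounded_clinear A" and B: "bounded_clinear B"
  shows "cinner (tensor_op tens A B v) u = cinner v (tensor_op tens (cadjoint A) (cadjoint B) u)"
proof -
  let ?T = "tensor_op tens A B" and ?S = "tensor_op tens (cadjoint A) (cadjoint B)"
  note adjs = bounded_clinear_cadjoint[OF A] bounded_clinear_cadjoint[OF B]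
  have T: "bounded_clinear ?T" and S: "bounded_clinear ?S"
    by (intro bounded_clinear_tensor_op tens A B adjs)+
  note bl = bounded_clinear_imp_bounded_linear[OF T] bounded_clinear_imp_bounded_linear[OF S]
  note cont = bl[THEN bounded_linear.continuous_on] continuous_on_id continuous_on_const
    continuous_on_cinner
  note simps = bounded_clinear_add[OF T] bounded_clinear_add[OF S]
    bounded_clinear_scaleC[OF T] bounded_clinear_scaleC[OF S]
    bl[THEN bounded_linear.linear, THEN linear_0]
    cinner_add_left cinner_add_right cinner_scaleC_left cinner_scaleC_right
  have elem: "cinner (?T v) (tens z w) = cinner v (?S (tens z w))" for v z w
    using tens
  proof (induction v rule: hilbert_tensor_induct)
    case closed
    show ?case by (intro closed_Collect_eq cont)
  next
    case (tensor x y)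
    show ?case
      by (simp add: tensor_op_tensor[OF tens] A B adjs cinner_tensor[OF tens]
          cinner_cadjoint[OF A] cinner_cadjoint[OF B])
  qed (simp_all add: simps)
  show ?thesis
    using tens
  proof (induction u rule: hilbert_tensor_induct)
    case closed
    show ?case by (intro closed_Collect_eq cont)
  next
    case (tensor x y)
    show ?case by (rule elem)
  qed (simp_all add: simps)
qed


section \<open>The lower bound for the tensor product\<close>

theorem theorem2p13:
  fixes tens :: "'h::chilbert_space \<Rightarrow> 'k::chilbert_space \<Rightarrow> 't::chilbert_space"
    and A :: "'h \<Rightarrow> 'h" and B :: "'k \<Rightarrow> 'k"
  assumes "hilbert_tensor_product tens"
    and "bounded_clinear A" and "bounded_clinear B"
  shows "(numerical_radius (tensor_op tens A B))\<^sup>2 \<ge>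
      onorm (\<lambda>v. tensor_op tens (cadjoint A \<circ> A) (cadjoint B \<circ> B) v
               + tensor_op tens (A \<circ> cadjoint A) (B \<circ> cadjoint B) v) / 4
    + \<bar>(onorm (\<lambda>v. tensor_op tens A B v + tensor_op tens (cadjoint A) (cadjoint B) v))\<^sup>2
       - (onorm (\<lambda>v. tensor_op tens A B v - tensor_op tens (cadjoint A) (cadjoint B) v))\<^sup>2\<bar> / 8"
proof -
  note adjs = bounded_clinear_cadjoint[OF assms(2)] bounded_clinear_cadjoint[OF assms(3)]
  show ?thesis
    using numerical_radius_square_ge[OF bounded_clinear_tensor_op[OF assms]
        bounded_clinear_tensor_op[OF assms(1) adjs] cinner_tensor_op_cadjoint[OF assms]]
    by (simp add: tensor_op_comp[OF assms(1)] assms adjs)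
qed

end
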